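(* Consider an implicit time stepping scheme of the form $\boldsymbol{A}\boldsymbol{f}_{k+1}=\boldsymbol{W}\boldsymbol{f}_k$, $k=0,1,2,\ldots$, with $\boldsymbol{A},\boldsymbol{W}$ linear operators on $\mathbb{R}^{n_1\times\cdots\times n_d}$ and $\boldsymbol{A}$ invertible, and suppose that $\|\boldsymbol{A}^{-1}\boldsymbol{W}\|<1$. Let $\hat{\boldsymbol{f}}_0=\boldsymbol{f}_0$ and denote by $\hat{\boldsymbol{f}}_k$ the (approximate) solution of $\boldsymbol{A}\hat{\boldsymbol{f}}_k=\boldsymbol{W}\hat{\boldsymbol{f}}_{k-1}$ ($k=1,2,\ldots$) obtained with the HT/TT-GMRES tensor solver with $m$ Krylov iterations and stopping tolerance $\eta$. If $$\left\|\boldsymbol{A}\hat{\boldsymbol{f}}_k-\boldsymbol{W}\hat{\boldsymbol{f}}_{k-1}\right\|\leq m\,\|\boldsymbol{A}\|\,\|\boldsymbol{A}^{-1}\|\,\eta\qquad\text{for all }k\geq1,$$ then for all $k\geq 1$ the distance between $\hat{\boldsymbol{f}}_k$ and the exact solution $\boldsymbol{f}_k=\boldsymbol{A}^{-1}\boldsymbol{W}\boldsymbol{f}_{k-1}$ can be bounded as $$\left\|\hat{\boldsymbol{f}}_k-\boldsymbol{f}_k\right\|\leq\frac{m\,\|\boldsymbol{A}\|\,\|\boldsymbol{A}^{-1}\|^2}{1-\|\boldsymbol{A}^{-1}\boldsymbol{W}\|}\,\eta.$$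
   Context: $\|\cdot\|$ denotes the standard tensor 2-norm (or a weighted version of it) on $\mathbb{R}^{n_1\times\cdots\times n_d}$ and, for linear operators, the induced operator norm. The scheme $\boldsymbol{A}\boldsymbol{f}_{k+1}=\boldsymbol{W}\boldsymbol{f}_k$ arises by applying an implicit time integrator to the linear problem $d\boldsymbol{f}/dt=\boldsymbol{L}\boldsymbol{f}$; e.g. $\boldsymbol{A}=\boldsymbol{I}-\Delta t\boldsymbol{L}$, $\boldsymbol{W}=\boldsymbol{I}$ for implicit Euler and $\boldsymbol{A}=\boldsymbol{I}-\tfrac12\Delta t\boldsymbol{L}$, $\boldsymbol{W}=\boldsymbol{I}+\tfrac12\Delta t\boldsymbol{L}$ for implicit midpoint. HT/TT-GMRES is an inexact restarted GMRES iteration for linear systems carried out in low-rank (hierarchical Tucker or tensor train) arithmetic; $m$ is the number of Krylov iterations performed before restart and $\eta>0$ is its tolerance. The only property of the computed tensors $\hat{\boldsymbol{f}}_k$ that is assumed is the residual bound displayed in the claim. *)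

theory Defs
  imports "HOL-Analysis.Analysis"
begin

definition tensor_indices :: "nat \<Rightarrow> (nat \<Rightarrow> nat) \<Rightarrow> (nat \<Rightarrow> nat) set" where
  "tensor_indices d n = (\<Pi>\<^sub>E j\<in>{1..d}. {1..n j})"

text \<open>The order \<open>d\<close> and the mode sizes \<open>n 1, \<dots>, n d\<close> are values, not types, so the space
  of real \<open>n 1 \<times> \<dots> \<times> n d\<close> tensors is an explicit carrier. Tensors are normalised to be \<open>0\<close>
  (rather than undefined) off the index set, so that the carrier is closed under
  pointwise addition and scaling and equality of tensors is equality of functions.\<close>

definition tensors :: "nat \<Rightarrow> (nat \<Rightarrow> nat) \<Rightarrow> ((nat \<Rightarrow> nat) \<Rightarrow> real) set" where
  "tensors d n = {x. \<forall>i. i \<notin> tensor_indices d n \<longrightarrow> x i = 0}"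

definition tensor_linear ::
  "nat \<Rightarrow> (nat \<Rightarrow> nat) \<Rightarrow> (((nat \<Rightarrow> nat) \<Rightarrow> real) \<Rightarrow> ((nat \<Rightarrow> nat) \<Rightarrow> real)) \<Rightarrow> bool" where
  "tensor_linear d n F \<longleftrightarrow>
     F \<in> tensors d n \<rightarrow> tensors d n \<and>
     (\<forall>x\<in>tensors d n. \<forall>y\<in>tensors d n. F (\<lambda>i. x i + y i) = (\<lambda>i. F x i + F y i)) \<and>
     (\<forall>c. \<forall>x\<in>tensors d n. F (\<lambda>i. c * x i) = (\<lambda>i. c * F x i))"

definition tensor_norm ::
  "nat \<Rightarrow> (nat \<Rightarrow> nat) \<Rightarrow> ((nat \<Rightarrow> nat) \<Rightarrow> real) \<Rightarrow> ((nat \<Rightarrow> nat) \<Rightarrow> real) \<Rightarrow> real" where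
  "tensor_norm d n w x = sqrt (\<Sum>i\<in>tensor_indices d n. w i * (x i)\<^sup>2)"

lemma tensor_norm_unweighted: "tensor_norm d n (\<lambda>_. 1) x = L2_set x (tensor_indices d n)"
  by (simp add: tensor_norm_def L2_set_def)

text \<open>As in the definition of \<^const>\<open>onorm\<close>, the zero tensor contributes the quotient \<open>0 / 0 = 0\<close>.\<close>

definition tensor_onorm ::
  "nat \<Rightarrow> (nat \<Rightarrow> nat) \<Rightarrow> ((nat \<Rightarrow> nat) \<Rightarrow> real) \<Rightarrow>
   (((nat \<Rightarrow> nat) \<Rightarrow> real) \<Rightarrow> ((nat \<Rightarrow> nat) \<Rightarrow> real)) \<Rightarrow> real" where
  "tensor_onorm d n w F = (SUP x\<in>tensors d n. tensor_norm d n w (F x) / tensor_norm d n w x)"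

text \<open>Meaningful only if \<open>F\<close> is a bijection of the carrier, and then only on the carrier.\<close>

abbreviation tensor_inv ::
  "nat \<Rightarrow> (nat \<Rightarrow> nat) \<Rightarrow> (((nat \<Rightarrow> nat) \<Rightarrow> real) \<Rightarrow> ((nat \<Rightarrow> nat) \<Rightarrow> real)) \<Rightarrow>
   ((nat \<Rightarrow> nat) \<Rightarrow> real) \<Rightarrow> ((nat \<Rightarrow> nat) \<Rightarrow> real)" where
  "tensor_inv d n F \<equiv> inv_into (tensors d n) F"

end

theory Submission imports Defs begin

text \<open>The error \<open>e\<^sub>k = fhat\<^sub>k - f\<^sub>k\<close> satisfies \<open>e\<^sub>k\<^sub>+\<^sub>1 = A\<inverse> r\<^sub>k\<^sub>+\<^sub>1 + A\<inverse> W e\<^sub>k\<close>, where \<open>r\<^sub>k\<close> is the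
  residual. Hence its norm obeys \<open>\<epsilon>\<^sub>k\<^sub>+\<^sub>1 \<le> \<beta> + q \<epsilon>\<^sub>k\<close> with \<open>q < 1\<close> and \<open>\<epsilon>\<^sub>0 = 0\<close>, and \<open>\<beta> / (1 - q)\<close> is
  the fixed point of this affine recursion. The operator norms may be used in this way because
  linear operators on a finite-dimensional space are bounded.\<close>

lemma finite_tensor_indices: "finite (tensor_indices d n)"
  unfolding tensor_indices_def by (rule finite_PiE) auto

lemma tensors_add: "x \<in> tensors d n \<Longrightarrow> y \<in> tensors d n \<Longrightarrow> (\<lambda>i. x i + y i) \<in> tensors d n"
  and tensors_scale: "x \<in> tensors d n \<Longrightarrow> (\<lambda>i. c * x i) \<in> tensors d n"
  and tensors_diff: "x \<in> tensors d n \<Longrightarrow> y \<in> tensors d n \<Longrightarrow> (\<lambda>i. x i - y i) \<in> tensors d n"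
  and zero_in_tensors: "(\<lambda>_. 0) \<in> tensors d n"
  by (simp_all add: tensors_def)

lemma tensor_linear_closed: "tensor_linear d n F \<Longrightarrow> x \<in> tensors d n \<Longrightarrow> F x \<in> tensors d n"
  by (auto simp: tensor_linear_def)

lemma tensor_linear_add:
  "tensor_linear d n F \<Longrightarrow> x \<in> tensors d n \<Longrightarrow> y \<in> tensors d n \<Longrightarrow>
    F (\<lambda>i. x i + y i) = (\<lambda>i. F x i + F y i)"
  by (simp add: tensor_linear_def)

lemma tensor_linear_scale:
  "tensor_linear d n F \<Longrightarrow> x \<in> tensors d n \<Longrightarrow> F (\<lambda>i. c * x i) = (\<lambda>i. c * F x i)"
  by (simp add: tensor_linear_def)

lemma tensor_linear_diff:
  assumes "tensor_linear d n F" "x \<in> tensors d n" "y \<in> tensors d n"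
  shows "F (\<lambda>i. x i - y i) = (\<lambda>i. F x i - F y i)"
  using tensor_linear_add[OF assms(1,2) tensors_scale[OF assms(3), of "-1"]]
    tensor_linear_scale[OF assms(1,3), of "-1"]
  by simp

lemma tensor_linear_zero: "tensor_linear d n F \<Longrightarrow> F (\<lambda>_. 0) = (\<lambda>_. 0)"
  using tensor_linear_scale[OF _ zero_in_tensors, of d n F 0] by simp

lemma tensor_linear_comp:
  assumes "tensor_linear d n F" "tensor_linear d n G"
  shows "tensor_linear d n (F \<circ> G)"
  using assms by (auto simp: tensor_linear_def Pi_iff)

lemma tensor_inv_apply:
  "bij_betw F (tensors d n) (tensors d n) \<Longrightarrow> x \<in> tensors d n \<Longrightarrow> tensor_inv d n F (F x) = x"
  by (rule bij_betw_inv_into_left)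

text \<open>Linearity is transported through \<open>F\<close>: it sends the sum (or multiple) of the
  preimages to the given sum (or multiple), and applying the inverse on the carrier recovers the
  former.\<close>

lemma tensor_linear_inv:
  assumes lin: "tensor_linear d n F" and bij: "bij_betw F (tensors d n) (tensors d n)"
  shows "tensor_linear d n (tensor_inv d n F)"
proof -
  let ?G = "tensor_inv d n F"
  have G: "?G x \<in> tensors d n" "F (?G x) = x" if "x \<in> tensors d n" for x
    using bij_betw_apply[OF bij_betw_inv_into[OF bij] that] bij_betw_inv_into_right[OF bij that]
    by simp_all
  have "?G (\<lambda>i. x i + y i) = (\<lambda>i. ?G x i + ?G y i)"
    if "x \<in> tensors d n" "y \<in> tensors d n" for x y
    using tensor_linear_add[OF lin G(1) G(1), of x y] G(2) that
      tensor_inv_apply[OF bij tensors_add[OF G(1) G(1)], of x y]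
    by simp
  moreover have "?G (\<lambda>i. c * x i) = (\<lambda>i. c * ?G x i)" if "x \<in> tensors d n" for c x
    using tensor_linear_scale[OF lin G(1), of x c] G(2) that
      tensor_inv_apply[OF bij tensors_scale[OF G(1)], of x c]
    by simp
  ultimately show ?thesis
    using G(1) by (simp add: tensor_linear_def)
qed

lemma tensor_norm_zero [simp]: "tensor_norm d n w (\<lambda>_. 0) = 0"
  by (simp add: tensor_norm_def)

text \<open>Positivity on the index set makes \<open>tensor_norm d n w\<close> a genuine norm on the
  carrier; it also permits division by \<open>sqrt (w i)\<close>.\<close>

locale positive_weights =
  fixes d :: nat and n :: "nat \<Rightarrow> nat" and w :: "(nat \<Rightarrow> nat) \<Rightarrow> real"
  assumes weight_pos: "i \<in> tensor_indices d n \<Longrightarrow> w i > 0"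
begin

text \<open>Rescaling each entry by the root of its weight turns the weighted norm into the
  Euclidean one, which then supplies nonnegativity and the triangle inequality.\<close>

lemma tensor_norm_L2_set:
  "tensor_norm d n w x = L2_set (\<lambda>i. sqrt (w i) * x i) (tensor_indices d n)"
  unfolding tensor_norm_def L2_set_def
  by (intro arg_cong[of _ _ sqrt] sum.cong refl) (simp add: power_mult_distrib weight_pos less_imp_le)

lemma tensor_norm_nonneg: "tensor_norm d n w x \<ge> 0"
  by (simp add: tensor_norm_L2_set L2_set_nonneg)

lemma tensor_norm_triangle:
  "tensor_norm d n w (\<lambda>i. x i + y i) \<le> tensor_norm d n w x + tensor_norm d n w y"
  using L2_set_triangle_ineq[of "\<lambda>i. sqrt (w i) * x i" "\<lambda>i. sqrt (w i) * y i" "tensor_indices d n"]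
  by (simp add: tensor_norm_L2_set distrib_left)

lemma tensor_norm_scale: "tensor_norm d n w (\<lambda>i. c * x i) = \<bar>c\<bar> * tensor_norm d n w x"
proof -
  have "(\<Sum>i\<in>tensor_indices d n. w i * (c * x i)\<^sup>2) = c\<^sup>2 * (\<Sum>i\<in>tensor_indices d n. w i * (x i)\<^sup>2)"
    by (simp add: sum_distrib_left power_mult_distrib mult_ac)
  then show ?thesis
    by (simp add: tensor_norm_def real_sqrt_mult)
qed

text \<open>A single summand is at most the whole sum of squares. This yields both definiteness of
  the norm and boundedness of linear operators.\<close>

lemma component_le_tensor_norm:
  assumes "i \<in> tensor_indices d n"
  shows "\<bar>x i\<bar> \<le> tensor_norm d n w x / sqrt (w i)"
proof -
  have "(sqrt (w i) * x i)\<^sup>2 \<le> (\<Sum>i\<in>tensor_indices d n. (sqrt (w i) * x i)\<^sup>2)"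
    using assms by (intro member_le_sum finite_tensor_indices) auto
  then have "\<bar>sqrt (w i) * x i\<bar> \<le> tensor_norm d n w x"
    unfolding tensor_norm_L2_set L2_set_def by (rule real_le_rsqrt[of "\<bar>_\<bar>", unfolded power2_abs])
  then show ?thesis
    using weight_pos[OF assms] by (simp add: abs_mult field_simps)
qed

lemma tensor_norm_eq_0:
  assumes "x \<in> tensors d n" "tensor_norm d n w x = 0"
  shows "x = (\<lambda>_. 0)"
proof
  fix i
  show "x i = 0"
    using component_le_tensor_norm[of i x] assms by (cases "i \<in> tensor_indices d n") (auto simp: tensors_def)
qed

text \<open>Expand \<open>x\<close> in the unit tensors of its support and apply the triangle
  inequality. The induction removes one index at a time; \<open>J\<close> stays within the index set
  so that these unit tensors lie in the carrier.\<close>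

lemma tensor_norm_linear_le_sum:
  assumes "tensor_linear d n F" "finite J" "J \<subseteq> tensor_indices d n" "\<And>i. i \<notin> J \<Longrightarrow> x i = 0"
  shows "tensor_norm d n w (F x) \<le> (\<Sum>j\<in>J. \<bar>x j\<bar> * tensor_norm d n w (F (\<lambda>i. of_bool (i = j))))"
  using assms(2-)
proof (induction J arbitrary: x rule: finite_induct)
  case empty
  then have "x = (\<lambda>_. 0)" by auto
  then show ?case
    by (simp add: tensor_linear_zero[OF assms(1)])
next
  case (insert j J)
  let ?e = "\<lambda>i. of_bool (i = j) :: real"
  \<comment> \<open>Erasing entry \<open>j\<close> leaves a tensor supported in \<open>J\<close>, to
    which the induction hypothesis applies.\<close>
  let ?y = "x(j := 0)"
  have e: "?e \<in> tensors d n" and y: "?y \<in> tensors d n"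
    using insert.prems by (auto simp: tensors_def)
  have IH: "tensor_norm d n w (F ?y) \<le> (\<Sum>k\<in>J. \<bar>?y k\<bar> * tensor_norm d n w (F (\<lambda>i. of_bool (i = k))))"
    using insert.prems by (intro insert.IH) auto
  \<comment> \<open>Since \<open>j\<close> is not in \<open>J\<close>, the erased entry does not
    occur in this sum.\<close>
  have *: "(\<Sum>k\<in>J. \<bar>?y k\<bar> * tensor_norm d n w (F (\<lambda>i. of_bool (i = k))))
      = (\<Sum>k\<in>J. \<bar>x k\<bar> * tensor_norm d n w (F (\<lambda>i. of_bool (i = k))))"
    using insert.hyps by (intro sum.cong) auto
  have "x = (\<lambda>i. x j * ?e i + ?y i)"
    by auto
  then have "F x = (\<lambda>i. x j * F ?e i + F ?y i)"
    using tensor_linear_add[OF assms(1) tensors_scale[OF e] y, of "x j"]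
      tensor_linear_scale[OF assms(1) e, of "x j"]
    by simp
  then have "tensor_norm d n w (F x) \<le> \<bar>x j\<bar> * tensor_norm d n w (F ?e) + tensor_norm d n w (F ?y)"
    using tensor_norm_triangle[of "\<lambda>i. x j * F ?e i" "F ?y"] by (simp add: tensor_norm_scale)
  then show ?case
    using IH * insert.hyps by simp
qed

lemma tensor_linear_bounded:
  assumes "tensor_linear d n F"
  shows "\<exists>C\<ge>0. \<forall>x\<in>tensors d n. tensor_norm d n w (F x) \<le> C * tensor_norm d n w x"
proof (intro exI conjI ballI)
  let ?N = "\<lambda>j. tensor_norm d n w (F (\<lambda>i. of_bool (i = j)))"
  \<comment> \<open>This constant results from bounding each entry in the unit tensor expansion by
    \<open>component_le_tensor_norm\<close>.\<close>
  let ?C = "\<Sum>j\<in>tensor_indices d n. ?N j / sqrt (w j)"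
  show "?C \<ge> 0"
    by (intro sum_nonneg divide_nonneg_nonneg tensor_norm_nonneg) (simp add: weight_pos less_imp_le)
  fix x assume "x \<in> tensors d n"
  then have "tensor_norm d n w (F x) \<le> (\<Sum>j\<in>tensor_indices d n. \<bar>x j\<bar> * ?N j)"
    by (intro tensor_norm_linear_le_sum assms finite_tensor_indices) (auto simp: tensors_def)
  also have "\<dots> \<le> (\<Sum>j\<in>tensor_indices d n. tensor_norm d n w x / sqrt (w j) * ?N j)"
    by (intro sum_mono mult_right_mono component_le_tensor_norm tensor_norm_nonneg)
  also have "\<dots> = ?C * tensor_norm d n w x"
    by (simp add: sum_distrib_left mult_ac)
  finally show "tensor_norm d n w (F x) \<le> ?C * tensor_norm d n w x" .
qed

text \<open>A real supremum is an upper bound only of a set that is bounded above, so every use of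
  \<open>tensor_onorm\<close> rests on this fact.\<close>

lemma bdd_above_tensor_quotients:
  assumes "tensor_linear d n F"
  shows "bdd_above ((\<lambda>x. tensor_norm d n w (F x) / tensor_norm d n w x) ` tensors d n)"
proof -
  obtain C where C: "C \<ge> 0" "\<And>x. x \<in> tensors d n \<Longrightarrow> tensor_norm d n w (F x) \<le> C * tensor_norm d n w x"
    using tensor_linear_bounded[OF assms] by blast
  have "tensor_norm d n w (F x) / tensor_norm d n w x \<le> C" if "x \<in> tensors d n" for x
    \<comment> \<open>When the denominator vanishes the quotient is 0 by convention, and
      \<open>C\<close> is nonnegative.\<close>
    using C(1) C(2)[OF that] tensor_norm_nonneg[of x]
    by (cases "tensor_norm d n w x = 0") (auto simp: divide_simps)
  then show ?thesis
    by (intro bdd_aboveI2)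
qed

lemma tensor_norm_le_onorm:
  assumes "tensor_linear d n F" "x \<in> tensors d n"
  shows "tensor_norm d n w (F x) \<le> tensor_onorm d n w F * tensor_norm d n w x"
proof (cases "tensor_norm d n w x = 0")
  case True
  \<comment> \<open>Here the quotient carries no information; definiteness gives that
    \<open>x\<close> is the zero tensor, and both sides vanish.\<close>
  then show ?thesis
    using tensor_norm_eq_0[OF assms(2)] tensor_linear_zero[OF assms(1)] by simp
next
  case False
  have "tensor_norm d n w (F x) / tensor_norm d n w x \<le> tensor_onorm d n w F"
    unfolding tensor_onorm_def by (rule cSUP_upper[OF assms(2) bdd_above_tensor_quotients[OF assms(1)]])
  then show ?thesis
    using False tensor_norm_nonneg[of x] by (simp add: field_simps)
qed

lemma tensor_onorm_nonneg:
  assumes "tensor_linear d n F"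
  shows "tensor_onorm d n w F \<ge> 0"
  unfolding tensor_onorm_def
  \<comment> \<open>The zero tensor contributes the quotient 0 to the supremum.\<close>
  by (rule cSUP_upper2[OF bdd_above_tensor_quotients[OF assms] zero_in_tensors]) simp

end

lemma affine_recursion_bound:
  fixes u :: "nat \<Rightarrow> real"
  assumes "0 \<le> q" "q < 1" "0 \<le> b" "u 0 \<le> 0" "\<And>k. u (Suc k) \<le> b + q * u k"
  shows "u k \<le> b / (1 - q)"
proof (induction k)
  case 0
  show ?case
    by (rule order_trans[OF assms(4)]) (use assms in simp)
next
  case (Suc k)
  \<comment> \<open>As \<open>q\<close> is nonnegative, the affine map is monotone and preserves the
    bound at its fixed point.\<close>
  have "u (Suc k) \<le> b + q * (b / (1 - q))"
    using assms(5)[of k] mult_left_mono[OF Suc \<open>0 \<le> q\<close>] by linarith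
  also have "\<dots> = b / (1 - q)"
    using \<open>q < 1\<close> by (simp add: field_simps)
  finally show ?case .
qed

theorem theorem2:
  fixes d :: nat and n :: "nat \<Rightarrow> nat"
    and w :: "(nat \<Rightarrow> nat) \<Rightarrow> real"
    and A W :: "((nat \<Rightarrow> nat) \<Rightarrow> real) \<Rightarrow> ((nat \<Rightarrow> nat) \<Rightarrow> real)"
    and f fhat :: "nat \<Rightarrow> ((nat \<Rightarrow> nat) \<Rightarrow> real)"
    and m :: nat and \<eta> :: real
  assumes "d \<ge> 1" and "\<And>j. j \<in> {1..d} \<Longrightarrow> n j \<ge> 1"
    and "\<And>i. i \<in> tensor_indices d n \<Longrightarrow> w i > 0"
    and "tensor_linear d n A" and "tensor_linear d n W"
    and "bij_betw A (tensors d n) (tensors d n)"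
    and "tensor_onorm d n w (tensor_inv d n A \<circ> W) < 1"
    and "\<And>k. f k \<in> tensors d n" and "\<And>k. A (f (Suc k)) = W (f k)"
    and "\<And>k. fhat k \<in> tensors d n" and "fhat 0 = f 0"
    and "\<eta> > 0"
    and "\<And>k. k \<ge> 1 \<Longrightarrow>
      tensor_norm d n w (\<lambda>i. A (fhat k) i - W (fhat (k - 1)) i)
        \<le> real m * tensor_onorm d n w A * tensor_onorm d n w (tensor_inv d n A) * \<eta>"
  shows "\<forall>k\<ge>1. tensor_norm d n w (\<lambda>i. fhat k i - f k i)
    \<le> real m * tensor_onorm d n w A * (tensor_onorm d n w (tensor_inv d n A))\<^sup>2
       / (1 - tensor_onorm d n w (tensor_inv d n A \<circ> W)) * \<eta>"
proof -
  interpret positive_weights d n w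
    by unfold_locales fact
  note linA = assms(4) and linW = assms(5) and bij = assms(6) and f = assms(8) and fhat = assms(10)
  let ?norm = "tensor_norm d n w" and ?onorm = "tensor_onorm d n w" and ?B = "tensor_inv d n A"
  define e where "e k = (\<lambda>i. fhat k i - f k i)" for k
  \<comment> \<open>The index is shifted: \<open>r k\<close> is the residual of the solve producing
    \<open>fhat (Suc k)\<close>.\<close>
  define r where "r k = (\<lambda>i. A (fhat (Suc k)) i - W (fhat k) i)" for k
  define R where "R = real m * ?onorm A * ?onorm ?B * \<eta>"
  have linB: "tensor_linear d n ?B"
    by (rule tensor_linear_inv[OF linA bij])
  have linBW: "tensor_linear d n (?B \<circ> W)"
    by (rule tensor_linear_comp[OF linB linW])
  have e: "e k \<in> tensors d n" for k
    unfolding e_def by (intro tensors_diff f fhat)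
  have r: "r k \<in> tensors d n" for k
    unfolding r_def by (intro tensors_diff tensor_linear_closed[OF linA] tensor_linear_closed[OF linW] fhat)
  have "R \<ge> 0"
    using \<open>\<eta> > 0\<close> by (simp add: R_def tensor_onorm_nonneg linA linB)
  have r_le: "?norm (r k) \<le> R" for k
    using assms(13)[of "Suc k"] by (simp add: r_def R_def)
  \<comment> \<open>Subtract the exact scheme from the definition of the residual.\<close>
  have "A (e (Suc k)) = (\<lambda>i. r k i + W (e k) i)" for k
    unfolding e_def r_def
    by (simp add: tensor_linear_diff[OF linA fhat f] tensor_linear_diff[OF linW fhat f] assms(9))
  \<comment> \<open>The inverse is applied to both sides; it cancels \<open>A\<close> because the
    error lies in the carrier.\<close>
  then have "e (Suc k) = (\<lambda>i. ?B (r k) i + (?B \<circ> W) (e k) i)" for k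
    using tensor_inv_apply[OF bij e, of "Suc k"]
      tensor_linear_add[OF linB r tensor_linear_closed[OF linW e], of k k]
    by simp
  then have "?norm (e (Suc k)) \<le> ?norm (?B (r k)) + ?norm ((?B \<circ> W) (e k))" for k
    using tensor_norm_triangle[of "?B (r k)" "(?B \<circ> W) (e k)"] by simp
  moreover have "?norm (?B (r k)) \<le> ?onorm ?B * R" for k
    using tensor_norm_le_onorm[OF linB r] mult_left_mono[OF r_le tensor_onorm_nonneg[OF linB]]
    by (rule order_trans)
  ultimately have step: "?norm (e (Suc k)) \<le> ?onorm ?B * R + ?onorm (?B \<circ> W) * ?norm (e k)" for k
    using tensor_norm_le_onorm[OF linBW e, of k] by (meson add_mono order_trans)
  have "?norm (e 0) \<le> 0"
    using \<open>fhat 0 = f 0\<close> by (simp add: e_def)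
  moreover have "0 \<le> ?onorm ?B * R"
    using tensor_onorm_nonneg[OF linB] \<open>R \<ge> 0\<close> by simp
  ultimately have "?norm (e k) \<le> ?onorm ?B * R / (1 - ?onorm (?B \<circ> W))" for k
    using affine_recursion_bound[where u = "\<lambda>k. ?norm (e k)",
        OF tensor_onorm_nonneg[OF linBW] assms(7) _ _ step]
    by blast
  \<comment> \<open>\<open>R\<close> already contains one factor \<open>?onorm ?B\<close>, so the
    product \<open>?onorm ?B * R\<close> produces the square.\<close>
  then show ?thesis
    by (simp add: e_def R_def power2_eq_square mult_ac)
qed

end
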